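(* Let $g$ be a smooth vector field on $\mathbb{R}^n$ and $\omega$ a smooth 1-form on $\mathbb{R}^n$ with $\omega(g)\neq0$ everywhere and $d\omega\wedge\omega=0$. For all sections $\bar m_1,\bar m_2$ of the quotient bundle $T\mathbb{R}^n/\mathrm{span}(g)$, $$\mathrm{an}_{\omega,g}\big(\langle\bar m_1,\bar m_2\rangle\big)=\big[\mathrm{an}_{\omega,g}(\bar m_1),\mathrm{an}_{\omega,g}(\bar m_2)\big].$$
   Context: A section $\bar m$ of $T\mathbb{R}^n/\mathrm{span}(g)$ is the class of a smooth vector field $m$ on $\mathbb{R}^n$ modulo $\{\alpha g:\alpha\in C^\infty(\mathbb{R}^n)\}$. The bracket $\langle\bar m_1,\bar m_2\rangle$ is the class of $$\langle m_1,m_2\rangle=[m_1,m_2]+\frac{\omega(m_2)}{\omega(g)}[g,m_1]-\frac{\omega(m_1)}{\omega(g)}[g,m_2],$$ which is independent of the representatives $m_1,m_2$. Here $[\cdot,\cdot]$ is the usual Lie bracket of vector fields. The anchor is $\mathrm{an}_{\omega,g}(\bar m):=m-\frac{\omega(m)}{\omega(g)}g$, a vector field on $\mathbb{R}^n$ independent of the representative $m$. *)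

theory Defs
  imports "HOL-Analysis.Analysis"
begin

primrec Ck :: "nat \<Rightarrow> ('a::euclidean_space \<Rightarrow> 'b::real_normed_vector) \<Rightarrow> bool" where
  "Ck 0 f \<longleftrightarrow> continuous_on UNIV f"
| "Ck (Suc k) f \<longleftrightarrow>
     (\<forall>x. f differentiable (at x)) \<and> (\<forall>v. Ck k (\<lambda>x. frechet_derivative f (at x) v))"

definition smooth :: "('a::euclidean_space \<Rightarrow> 'b::real_normed_vector) \<Rightarrow> bool" where
  "smooth f \<longleftrightarrow> (\<forall>k. Ck k f)"

text \<open>The tangent and cotangent bundles of \<open>\<real>\<^sup>n\<close> are trivialised: a vector field is its
  tuple of components, and a 1-form is a map into the dual space.\<close>

type_synonym 'n vfield = "real ^ 'n \<Rightarrow> real ^ 'n"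
type_synonym 'n oneform = "real ^ 'n \<Rightarrow> ((real ^ 'n) \<Rightarrow>\<^sub>L real)"
type_synonym 'n twoform = "real ^ 'n \<Rightarrow> real ^ 'n \<Rightarrow> real ^ 'n \<Rightarrow> real"
type_synonym 'n threeform = "real ^ 'n \<Rightarrow> real ^ 'n \<Rightarrow> real ^ 'n \<Rightarrow> real ^ 'n \<Rightarrow> real"

definition contract :: "'n::finite oneform \<Rightarrow> 'n vfield \<Rightarrow> real ^ 'n \<Rightarrow> real" where
  "contract \<omega> X = (\<lambda>x. blinfun_apply (\<omega> x) (X x))"

text \<open>With this sign, \<open>[X, Y]\<close> acts on functions as \<open>X \<circ> Y - Y \<circ> X\<close>.\<close>

definition lie_bracket :: "'n::finite vfield \<Rightarrow> 'n vfield \<Rightarrow> 'n vfield" where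
  "lie_bracket X Y =
     (\<lambda>x. frechet_derivative Y (at x) (X x) - frechet_derivative X (at x) (Y x))"

text \<open>For \<open>\<omega> = \<Sum>\<^sub>i \<omega>\<^sub>i dx\<^sub>i\<close> this is \<open>\<Sum>\<^sub>i d\<omega>\<^sub>i \<and> dx\<^sub>i\<close> evaluated at the tangent vectors
  \<open>u\<close>, \<open>v\<close>.\<close>

definition ext_deriv :: "'n::finite oneform \<Rightarrow> 'n twoform" where
  "ext_deriv \<omega> = (\<lambda>x u v.
     blinfun_apply (frechet_derivative \<omega> (at x) u) v -
     blinfun_apply (frechet_derivative \<omega> (at x) v) u)"

text \<open>The general wedge product is a signed sum over shuffles; the (2,1)-shuffles are the three
  cyclic permutations, all of which are even.\<close>

definition wedge21 :: "'n::finite twoform \<Rightarrow> 'n oneform \<Rightarrow> 'n threeform" where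
  "wedge21 \<beta> \<omega> = (\<lambda>x u v w.
     \<beta> x u v * blinfun_apply (\<omega> x) w +
     \<beta> x v w * blinfun_apply (\<omega> x) u +
     \<beta> x w u * blinfun_apply (\<omega> x) v)"

definition mod_span_rel :: "'n::finite vfield \<Rightarrow> ('n vfield \<times> 'n vfield) set" where
  "mod_span_rel g = {(m, m'). smooth m \<and> smooth m' \<and>
     (\<exists>\<alpha> :: real ^ 'n \<Rightarrow> real. smooth \<alpha> \<and> (\<forall>x. m x - m' x = \<alpha> x *\<^sub>R g x))}"

definition quotient_sections :: "'n::finite vfield \<Rightarrow> 'n vfield set set" where
  "quotient_sections g = {m. smooth m} // mod_span_rel g"

definition bracket_rep ::
    "'n::finite oneform \<Rightarrow> 'n vfield \<Rightarrow> 'n vfield \<Rightarrow> 'n vfield \<Rightarrow> 'n vfield" where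
  "bracket_rep \<omega> g m1 m2 = (\<lambda>x.
     lie_bracket m1 m2 x
     + (contract \<omega> m2 x / contract \<omega> g x) *\<^sub>R lie_bracket g m1 x
     - (contract \<omega> m1 x / contract \<omega> g x) *\<^sub>R lie_bracket g m2 x)"

definition anchor_rep :: "'n::finite oneform \<Rightarrow> 'n vfield \<Rightarrow> 'n vfield \<Rightarrow> 'n vfield" where
  "anchor_rep \<omega> g m = (\<lambda>x. m x - (contract \<omega> m x / contract \<omega> g x) *\<^sub>R g x)"

text \<open>The operations on classes collect the values on all representatives. The application of
  \<^const>\<open>the_elem\<close> is meaningful because these values coincide when \<open>\<omega>\<close> and \<open>g\<close> are smooth and
  \<open>\<omega>(g)\<close> has no zeros.\<close>

definition bracket ::
    "'n::finite oneform \<Rightarrow> 'n vfield \<Rightarrow> 'n vfield set \<Rightarrow> 'n vfield set \<Rightarrow> 'n vfield set" where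
  "bracket \<omega> g M1 M2 =
     the_elem (\<Union>m1\<in>M1. \<Union>m2\<in>M2. {mod_span_rel g `` {bracket_rep \<omega> g m1 m2}})"

definition anchor :: "'n::finite oneform \<Rightarrow> 'n vfield \<Rightarrow> 'n vfield set \<Rightarrow> 'n vfield" where
  "anchor \<omega> g M = the_elem (anchor_rep \<omega> g ` M)"

end

(* The anchored fields X_i = an(m_i) take values in the kernel of \<omega>, which is involutive because
   d\<omega> \<and> \<omega> = 0 and \<omega>(g) has no zeros. Expanding [X_1, X_2] gives the bracket of m_1 and m_2 plus a
   multiple of g, and the anchor of a vector is its only translate along g that lies in the kernel
   of \<omega>. *)

theory Submission
  imports Defs
begin

section \<open>Calculus of smooth functions\<close>

lemma Ck_SucD: "Ck (Suc k) f \<Longrightarrow> Ck k f"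
proof (induction k arbitrary: f)
  case 0
  then show ?case
    by (auto intro!: continuous_at_imp_continuous_on differentiable_imp_continuous_within)
next
  case (Suc k)
  then show ?case
    by (metis Ck.simps(2))
qed

text \<open>\<open>Ck\<close> refers to the derivative through the choice operator
  \<open>frechet_derivative\<close>. Uniqueness of the derivative lets any explicit formula
  \<open>f'\<close> stand in for it, which is how the rules of calculus enter the inductions
  below.\<close>

lemma Ck_SucI:
  assumes D: "\<And>x. (f has_derivative f' x) (at x)" and "\<And>v. Ck k (\<lambda>x. f' x v)"
  shows "Ck (Suc k) f"
proof -
  have "frechet_derivative f (at x) = f' x" for x
    by (rule frechet_derivative_at[OF D, symmetric])
  then show ?thesis
    using assms by (auto simp: differentiable_def)
qed

lemma Ck_Suc_has_derivative:
  "Ck (Suc k) f \<Longrightarrow> (f has_derivative frechet_derivative f (at x)) (at x)"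
  by (simp add: frechet_derivative_works)

lemma Ck_Suc_frechet_derivative: "Ck (Suc k) f \<Longrightarrow> Ck k (\<lambda>x. frechet_derivative f (at x) v)"
  by simp

lemma Ck_const: "Ck k (\<lambda>x. c)"
  by (induction k arbitrary: c) auto

lemma Ck_add:
  assumes "Ck k f" "Ck k g"
  shows "Ck k (\<lambda>x. f x + g x)"
  using assms
proof (induction k arbitrary: f g)
  case 0
  then show ?case by (auto intro: continuous_on_add)
next
  case (Suc k)
  note D = Suc.prems[THEN Ck_Suc_has_derivative] Suc.prems[THEN Ck_Suc_frechet_derivative]
  show ?case
    by (rule Ck_SucI[OF has_derivative_add[OF D(1,2)]]) (intro Suc.IH D(3,4))
qed

text \<open>One Leibniz rule for all products: real multiplication, scaling, inner product and
  evaluation of a 1-form. The derivative is a sum of two terms of the same shape, each containing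
  one undifferentiated factor, whose order is lowered by \<open>Ck_SucD\<close>.\<close>

lemma Ck_bounded_bilinear:
  assumes B: "bounded_bilinear B" and "Ck k f" "Ck k g"
  shows "Ck k (\<lambda>x. B (f x) (g x))"
  using assms(2,3)
proof (induction k arbitrary: f g)
  case 0
  then show ?case by (auto intro: bounded_bilinear.continuous_on[OF B])
next
  case (Suc k)
  note D = Suc.prems[THEN Ck_Suc_has_derivative] Suc.prems[THEN Ck_Suc_frechet_derivative]
  show ?case
    by (rule Ck_SucI[OF bounded_bilinear.FDERIV[OF B D(1,2)]])
      (intro Ck_add Suc.IH D(3,4) Suc.prems[THEN Ck_SucD])
qed

lemma Ck_inverse:
  fixes f :: "'a::euclidean_space \<Rightarrow> real"
  assumes "Ck k f" and nz: "\<And>x. f x \<noteq> 0"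
  shows "Ck k (\<lambda>x. inverse (f x))"
  using assms(1)
proof (induction k)
  case 0
  then show ?case using nz by (auto intro!: continuous_intros)
next
  case (Suc k)
  note D = Ck_Suc_has_derivative[OF Suc.prems] Ck_Suc_frechet_derivative[OF Suc.prems]
  \<comment> \<open>The sign is written as a factor \<open>- 1\<close>, so that the derivative is a
    pure product and the bilinear rule together with the induction hypothesis for
    \<open>inverse (f x)\<close> covers it.\<close>
  have "((\<lambda>x. inverse (f x)) has_derivative
      (\<lambda>h. - 1 * (inverse (f x) * frechet_derivative f (at x) h * inverse (f x)))) (at x)" for x
    using Deriv.has_derivative_inverse[OF nz D(1)] by simp
  then show ?case
    by (rule Ck_SucI)
      (intro Ck_bounded_bilinear[OF bounded_bilinear_mult] Ck_const Suc.IH D(2) Ck_SucD[OF Suc.prems])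
qed

lemma smooth_const: "smooth (\<lambda>x. c)"
  by (simp add: smooth_def Ck_const)

lemma smooth_add: "smooth f \<Longrightarrow> smooth g \<Longrightarrow> smooth (\<lambda>x. f x + g x)"
  by (simp add: smooth_def Ck_add)

lemma smooth_bounded_bilinear:
  "bounded_bilinear B \<Longrightarrow> smooth f \<Longrightarrow> smooth g \<Longrightarrow> smooth (\<lambda>x. B (f x) (g x))"
  by (simp add: smooth_def Ck_bounded_bilinear)

lemmas smooth_mult = smooth_bounded_bilinear[OF bounded_bilinear_mult]
lemmas smooth_scaleR = smooth_bounded_bilinear[OF bounded_bilinear_scaleR]
lemmas smooth_inner = smooth_bounded_bilinear[OF bounded_bilinear_inner]

lemma smooth_uminus: "smooth f \<Longrightarrow> smooth (\<lambda>x. - f x)"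
  using smooth_scaleR[OF smooth_const[of "-1"], of f] by simp

lemma smooth_diff: "smooth f \<Longrightarrow> smooth g \<Longrightarrow> smooth (\<lambda>x. f x - g x)"
  using smooth_add[OF _ smooth_uminus, of f g] by simp

lemma smooth_sum: "(\<And>i. i \<in> I \<Longrightarrow> smooth (f i)) \<Longrightarrow> smooth (\<lambda>x. \<Sum>i\<in>I. f i x)"
  by (induction I rule: infinite_finite_induct) (auto intro: smooth_const smooth_add)

lemma smooth_divide:
  fixes f g :: "'a::euclidean_space \<Rightarrow> real"
  shows "smooth f \<Longrightarrow> smooth g \<Longrightarrow> (\<And>x. g x \<noteq> 0) \<Longrightarrow> smooth (\<lambda>x. f x / g x)"
  unfolding divide_inverse by (intro smooth_mult) (auto simp: smooth_def Ck_inverse)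

lemma smooth_imp_differentiable: "smooth f \<Longrightarrow> f differentiable (at x)"
  using Ck.simps(2) smooth_def by blast

lemma smooth_has_derivative: "smooth f \<Longrightarrow> (f has_derivative frechet_derivative f (at x)) (at x)"
  using smooth_imp_differentiable frechet_derivative_works by blast

text \<open>Smoothness controls derivatives in fixed directions only. Expanding \<open>X x\<close>
  in the standard basis reduces the moving direction to finitely many fixed ones with smooth
  coefficients.\<close>

lemma smooth_frechet_derivative:
  assumes "smooth f" "smooth X"
  shows "smooth (\<lambda>x. frechet_derivative f (at x) (X x))"
proof -
  have "frechet_derivative f (at x) (X x) =
      (\<Sum>b\<in>Basis. (X x \<bullet> b) *\<^sub>R frechet_derivative f (at x) b)" for x
  proof -
    have "linear (frechet_derivative f (at x))"
      using assms(1) smooth_imp_differentiable linear_frechet_derivative by blast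
    then show ?thesis
      by (subst euclidean_representation[symmetric, of "X x"])
        (simp add: linear_sum linear_scale)
  qed
  moreover have "smooth (\<lambda>x. frechet_derivative f (at x) b)" for b
    using assms(1) Ck.simps(2) unfolding smooth_def by blast
  ultimately show ?thesis
    using assms(2) by (auto intro!: smooth_sum smooth_scaleR smooth_inner smooth_const)
qed

section \<open>Lie brackets\<close>

lemma smooth_lie_bracket: "smooth X \<Longrightarrow> smooth Y \<Longrightarrow> smooth (lie_bracket X Y)"
  unfolding lie_bracket_def by (intro smooth_diff smooth_frechet_derivative)

lemma lie_bracket_swap: "lie_bracket X Y x = - lie_bracket Y X x"
  by (simp add: lie_bracket_def)

text \<open>Leibniz rule \<open>[a g, Y] = a [g, Y] - Y(a) g\<close>, combined with additivity of
  the bracket.\<close>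

lemma lie_bracket_add_scaleR_left:
  assumes "smooth X" "smooth a" "smooth g" "smooth Y"
  shows "lie_bracket (\<lambda>x. X x + a x *\<^sub>R g x) Y x =
    lie_bracket X Y x + a x *\<^sub>R lie_bracket g Y x - frechet_derivative a (at x) (Y x) *\<^sub>R g x"
proof -
  let ?D = "\<lambda>h. frechet_derivative X (at x) h +
    (a x *\<^sub>R frechet_derivative g (at x) h + frechet_derivative a (at x) h *\<^sub>R g x)"
  have "((\<lambda>x. X x + a x *\<^sub>R g x) has_derivative ?D) (at x)"
    using assms by (intro has_derivative_add has_derivative_scaleR smooth_has_derivative)
  then have D: "frechet_derivative (\<lambda>x. X x + a x *\<^sub>R g x) (at x) = ?D"
    by (rule frechet_derivative_at[symmetric])
  have "linear (frechet_derivative Y (at x))"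
    using assms(4) smooth_imp_differentiable linear_frechet_derivative by blast
  then show ?thesis
    unfolding lie_bracket_def D by (simp add: algebra_simps linear_add linear_scale)
qed

text \<open>All derivatives of the coefficients \<open>a\<close> and \<open>b\<close> multiply
  \<open>g\<close>, and \<open>[g, g] = 0\<close> removes the term in \<open>a b\<close>. The anchor
  annihilates multiples of \<open>g\<close>, so the remainder is hidden in a single real
  \<open>c\<close> at the point \<open>x\<close>.\<close>

lemma lie_bracket_add_scaleR:
  assumes "smooth X" "smooth a" "smooth g" "smooth Y" "smooth b"
  obtains c where "lie_bracket (\<lambda>x. X x + a x *\<^sub>R g x) (\<lambda>x. Y x + b x *\<^sub>R g x) x =
    lie_bracket X Y x + a x *\<^sub>R lie_bracket g Y x - b x *\<^sub>R lie_bracket g X x + c *\<^sub>R g x"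
proof
  let ?Y = "\<lambda>x. Y x + b x *\<^sub>R g x"
  let ?da = "frechet_derivative a (at x)" and ?db = "frechet_derivative b (at x)"
  have "smooth ?Y"
    using assms by (intro smooth_add smooth_scaleR)
  then have "lie_bracket (\<lambda>x. X x + a x *\<^sub>R g x) ?Y x =
      lie_bracket X ?Y x + a x *\<^sub>R lie_bracket g ?Y x - ?da (?Y x) *\<^sub>R g x"
    using assms by (intro lie_bracket_add_scaleR_left)
  \<comment> \<open>Antisymmetry carries the rule for the left argument over to the right
    one.\<close>
  moreover have "lie_bracket X ?Y x = lie_bracket X Y x - b x *\<^sub>R lie_bracket g X x + ?db (X x) *\<^sub>R g x"
    using assms lie_bracket_swap[of X ?Y x] lie_bracket_swap[of X Y x]
    by (simp add: lie_bracket_add_scaleR_left)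
  moreover have "lie_bracket g ?Y x = lie_bracket g Y x + ?db (g x) *\<^sub>R g x"
    using assms lie_bracket_swap[of g ?Y x] lie_bracket_swap[of g Y x]
    by (simp add: lie_bracket_add_scaleR_left) (simp add: lie_bracket_def)
  ultimately show "lie_bracket (\<lambda>x. X x + a x *\<^sub>R g x) ?Y x =
      lie_bracket X Y x + a x *\<^sub>R lie_bracket g Y x - b x *\<^sub>R lie_bracket g X x +
      (?db (X x) + a x * ?db (g x) - ?da (?Y x)) *\<^sub>R g x"
    by (simp only:) (simp add: algebra_simps)
qed

section \<open>1-forms, the exterior derivative and involutivity of the kernel\<close>

lemma smooth_contract: "smooth \<omega> \<Longrightarrow> smooth X \<Longrightarrow> smooth (contract \<omega> X)"
  unfolding contract_def by (rule smooth_bounded_bilinear[OF bounded_bilinear_blinfun_apply])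

text \<open>Cartan's formula. By the product rule for \<open>contract\<close>, the terms that
  differentiate \<open>X\<close> and \<open>Y\<close> assemble to \<omega> of the bracket and
  cancel, leaving those that differentiate \<omega>.\<close>

lemma ext_deriv_eq_lie_bracket:
  assumes "smooth \<omega>" "smooth X" "smooth Y"
  shows "ext_deriv \<omega> x (X x) (Y x) =
    frechet_derivative (contract \<omega> Y) (at x) (X x) -
    frechet_derivative (contract \<omega> X) (at x) (Y x) - contract \<omega> (lie_bracket X Y) x"
proof -
  have "frechet_derivative (contract \<omega> Z) (at x) h =
      \<omega> x (frechet_derivative Z (at x) h) + frechet_derivative \<omega> (at x) h (Z x)"
    if "smooth Z" for Z :: "real ^ 'a \<Rightarrow> real ^ 'a" and h
  proof -
    have "(contract \<omega> Z has_derivative (\<lambda>h. \<omega> x (frechet_derivative Z (at x) h) +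
        frechet_derivative \<omega> (at x) h (Z x))) (at x)"
      unfolding contract_def using assms(1) that
      by (intro bounded_bilinear.FDERIV[OF bounded_bilinear_blinfun_apply] smooth_has_derivative)
    from frechet_derivative_at[OF this, symmetric] show ?thesis
      by simp
  qed
  then show ?thesis
    using assms(2,3) by (simp add: ext_deriv_def lie_bracket_def contract_def blinfun.diff_right)
qed

text \<open>The involutivity half of Frobenius' theorem. Evaluated at \<open>X\<close>,
  \<open>Y\<close>, \<open>g\<close>, the wedge product keeps only the term with the factor
  \<open>contract \<omega> g x\<close>, so the exterior derivative vanishes on \<open>X\<close>,
  \<open>Y\<close>; Cartan's formula then leaves only \<omega> of the bracket.\<close>

lemma lie_bracket_in_kernel:
  assumes "smooth \<omega>" "smooth X" "smooth Y"
    and "\<And>x. contract \<omega> X x = 0" "\<And>x. contract \<omega> Y x = 0"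
    and "contract \<omega> g x \<noteq> 0" "\<And>u v w. wedge21 (ext_deriv \<omega>) \<omega> x u v w = 0"
  shows "contract \<omega> (lie_bracket X Y) x = 0"
proof -
  have "ext_deriv \<omega> x (X x) (Y x) = 0"
    using assms(7)[of "X x" "Y x" "g x"] assms(4)[of x] assms(5)[of x] assms(6)
    by (simp add: wedge21_def contract_def)
  moreover have "contract \<omega> X = (\<lambda>_. 0)" "contract \<omega> Y = (\<lambda>_. 0)"
    using assms(4,5) by auto
  ultimately show ?thesis
    using ext_deriv_eq_lie_bracket[OF assms(1-3), of x] by simp
qed

section \<open>Sections of the quotient bundle\<close>

lemma equiv_mod_span_rel:
  fixes g :: "real ^ 'n \<Rightarrow> real ^ 'n"
  shows "equiv {m. smooth m} (mod_span_rel g)"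
proof (rule equivI)
  show "mod_span_rel g \<subseteq> {m. smooth m} \<times> {m. smooth m}"
    by (auto simp: mod_span_rel_def)
  show "refl_on {m. smooth m} (mod_span_rel g)"
    by (auto simp: refl_on_def mod_span_rel_def intro!: exI[of _ "\<lambda>_. 0"] smooth_const)
  show "sym (mod_span_rel g)"
  proof (rule symI)
    fix m m' assume "(m, m') \<in> mod_span_rel g"
    then obtain \<alpha> :: "real ^ 'n \<Rightarrow> real" where "smooth m" "smooth m'" "smooth \<alpha>"
      "\<And>x. m x - m' x = \<alpha> x *\<^sub>R g x"
      by (auto simp: mod_span_rel_def)
    moreover from this have "m' x - m x = - \<alpha> x *\<^sub>R g x" for x
      by (metis minus_diff_eq scaleR_minus_left)
    ultimately show "(m', m) \<in> mod_span_rel g"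
      using smooth_uminus[of \<alpha>] by (auto simp: mod_span_rel_def intro!: exI[of _ "\<lambda>x. - \<alpha> x"])
  qed
  show "trans (mod_span_rel g)"
  proof (rule transI)
    fix m m' m'' assume "(m, m') \<in> mod_span_rel g" "(m', m'') \<in> mod_span_rel g"
    then obtain \<alpha> \<beta> :: "real ^ 'n \<Rightarrow> real" where "smooth m" "smooth m''" "smooth \<alpha>" "smooth \<beta>"
      "\<And>x. m x - m' x = \<alpha> x *\<^sub>R g x" "\<And>x. m' x - m'' x = \<beta> x *\<^sub>R g x"
      by (auto simp: mod_span_rel_def)
    moreover from this have "m x - m'' x = (\<alpha> x + \<beta> x) *\<^sub>R g x" for x
      unfolding scaleR_add_left by (metis diff_add_cancel add_diff_eq)
    ultimately show "(m, m'') \<in> mod_span_rel g"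
      using smooth_add[of \<alpha> \<beta>] by (auto simp: mod_span_rel_def intro!: exI[of _ "\<lambda>x. \<alpha> x + \<beta> x"])
  qed
qed

section \<open>The anchor and the bracket on representatives\<close>

context
  fixes g :: "real ^ 'n \<Rightarrow> real ^ 'n"
    and \<omega> :: "real ^ 'n \<Rightarrow> ((real ^ 'n) \<Rightarrow>\<^sub>L real)"
  assumes g: "smooth g" and \<omega>: "smooth \<omega>" and transversal: "\<And>x. contract \<omega> g x \<noteq> 0"
begin

lemma smooth_contract_ratio: "smooth m \<Longrightarrow> smooth (\<lambda>x. contract \<omega> m x / contract \<omega> g x)"
  by (intro smooth_divide smooth_contract g \<omega> transversal)

lemma smooth_anchor_rep: "smooth m \<Longrightarrow> smooth (anchor_rep \<omega> g m)"
  unfolding anchor_rep_def by (intro smooth_diff smooth_scaleR smooth_contract_ratio g)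

lemma smooth_bracket_rep: "smooth m1 \<Longrightarrow> smooth m2 \<Longrightarrow> smooth (bracket_rep \<omega> g m1 m2)"
  unfolding bracket_rep_def
  by (intro smooth_diff smooth_add smooth_scaleR smooth_contract_ratio smooth_lie_bracket g)

lemma contract_anchor_rep: "contract \<omega> (anchor_rep \<omega> g m) x = 0"
  using transversal[of x]
  by (simp add: anchor_rep_def contract_def blinfun.diff_right blinfun.scaleR_right)

text \<open>Adding \<open>c\<close> times \<open>g\<close> raises the ratio of contractions by
  exactly \<open>c\<close>, so the two changes cancel. The form at a single point also admits a
  \<open>c\<close> that is known only there.\<close>

lemma anchor_rep_cong:
  assumes "m x - m' x = c *\<^sub>R g x"
  shows "anchor_rep \<omega> g m x = anchor_rep \<omega> g m' x"
proof -
  have m: "m x = m' x + c *\<^sub>R g x"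
    using assms by (simp add: algebra_simps)
  then have "contract \<omega> m x / contract \<omega> g x = contract \<omega> m' x / contract \<omega> g x + c"
    using transversal[of x]
    by (simp add: contract_def blinfun.add_right blinfun.scaleR_right add_divide_distrib)
  then show ?thesis
    by (simp add: anchor_rep_def m scaleR_add_left)
qed

lemma anchor_rep_eq_self: "contract \<omega> m x = 0 \<Longrightarrow> anchor_rep \<omega> g m x = m x"
  by (simp add: anchor_rep_def)

lemma bracket_rep_swap: "bracket_rep \<omega> g m1 m2 x = - bracket_rep \<omega> g m2 m1 x"
  using lie_bracket_swap[of m1 m2 x] by (simp add: bracket_rep_def)

text \<open>Replacing \<open>m'\<close> by \<open>m' + \<alpha> g\<close> adds
  \<open>\<alpha> [g, n]\<close> to the Lie bracket, and the correction term with
  \<open>[g, n]\<close> takes it away again. The other changes are smooth multiples of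
  \<open>g\<close>.\<close>

lemma bracket_rep_cong_left:
  assumes "(m, m') \<in> mod_span_rel g" "smooth n"
  shows "(bracket_rep \<omega> g m n, bracket_rep \<omega> g m' n) \<in> mod_span_rel g"
proof -
  obtain \<alpha> :: "real ^ 'n \<Rightarrow> real" where \<alpha>: "smooth m" "smooth m'" "smooth \<alpha>"
      "\<And>x. m x - m' x = \<alpha> x *\<^sub>R g x"
    using assms(1) by (auto simp: mod_span_rel_def)
  then have m: "m = (\<lambda>x. m' x + \<alpha> x *\<^sub>R g x)"
    by (auto simp: fun_eq_iff algebra_simps)
  \<comment> \<open>The first summand comes from \<open>[g, m]\<close>, weighted by its coefficient
    in \<open>bracket_rep\<close>; the second comes from \<open>[m, n]\<close>.\<close>
  define c where "c x = contract \<omega> n x / contract \<omega> g x * frechet_derivative \<alpha> (at x) (g x)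
    - frechet_derivative \<alpha> (at x) (n x)" for x
  have "bracket_rep \<omega> g m n x - bracket_rep \<omega> g m' n x = c x *\<^sub>R g x" for x
  proof -
    have 1: "lie_bracket m n x =
        lie_bracket m' n x + \<alpha> x *\<^sub>R lie_bracket g n x - frechet_derivative \<alpha> (at x) (n x) *\<^sub>R g x"
      unfolding m using \<alpha> g assms(2) by (intro lie_bracket_add_scaleR_left)
    have "lie_bracket m g x = lie_bracket m' g x - frechet_derivative \<alpha> (at x) (g x) *\<^sub>R g x"
      unfolding m using \<alpha> g lie_bracket_add_scaleR_left[of m' \<alpha> g g x] by (simp add: lie_bracket_def)
    then have 2: "lie_bracket g m x = lie_bracket g m' x + frechet_derivative \<alpha> (at x) (g x) *\<^sub>R g x"
      using lie_bracket_swap[of g m x] lie_bracket_swap[of g m' x] by simp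
    have 3: "contract \<omega> m x / contract \<omega> g x = contract \<omega> m' x / contract \<omega> g x + \<alpha> x"
      using transversal[of x] unfolding m
      by (simp add: contract_def blinfun.add_right blinfun.scaleR_right add_divide_distrib)
    show ?thesis
      unfolding bracket_rep_def 1 2 3 c_def by (simp add: algebra_simps)
  qed
  moreover have "smooth c"
    unfolding c_def
    by (intro smooth_diff smooth_mult smooth_uminus smooth_frechet_derivative smooth_contract_ratio
        g \<alpha> assms(2))
  ultimately show ?thesis
    using \<alpha>(1,2) assms(2) by (auto simp: mod_span_rel_def smooth_bracket_rep)
qed

lemma bracket_rep_cong_right:
  assumes "(m, m') \<in> mod_span_rel g" "smooth n"
  shows "(bracket_rep \<omega> g n m, bracket_rep \<omega> g n m') \<in> mod_span_rel g"
proof -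
  \<comment> \<open>The pair is reversed because swapping the arguments negates both brackets, which
    turns their difference around.\<close>
  have "(bracket_rep \<omega> g m' n, bracket_rep \<omega> g m n) \<in> mod_span_rel g"
    using bracket_rep_cong_left[OF assms] equiv_mod_span_rel[of g] by (auto elim: equivE dest: symD)
  moreover have "smooth m" "smooth m'"
    using assms(1) by (auto simp: mod_span_rel_def)
  ultimately show ?thesis
    using assms(2) bracket_rep_swap[of n m] bracket_rep_swap[of n m']
    by (simp add: mod_span_rel_def smooth_bracket_rep)
qed

section \<open>Passage to classes and the morphism property\<close>

lemma anchor_class:
  assumes "smooth m"
  shows "anchor \<omega> g (mod_span_rel g `` {m}) = anchor_rep \<omega> g m"
proof -
  have "anchor_rep \<omega> g m' = anchor_rep \<omega> g m" if "(m, m') \<in> mod_span_rel g" for m'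
    using that anchor_rep_cong[of m _ m'] by (fastforce simp: mod_span_rel_def)
  moreover have "m \<in> mod_span_rel g `` {m}"
    using assms equiv_class_self[OF equiv_mod_span_rel] by blast
  ultimately have "anchor_rep \<omega> g ` (mod_span_rel g `` {m}) = {anchor_rep \<omega> g m}"
    by blast
  then show ?thesis
    by (simp add: anchor_def)
qed

text \<open>The congruence in both arguments makes the double union a singleton, on which
  \<open>the_elem\<close> returns the expected class.\<close>

lemma bracket_class:
  assumes "smooth m1" "smooth m2"
  shows "bracket \<omega> g (mod_span_rel g `` {m1}) (mod_span_rel g `` {m2}) =
    mod_span_rel g `` {bracket_rep \<omega> g m1 m2}"
proof -
  note E = equiv_mod_span_rel[of g]
  have "congruent2 (mod_span_rel g) (mod_span_rel g)
      (\<lambda>m1 m2. {mod_span_rel g `` {bracket_rep \<omega> g m1 m2}})"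
    using equiv_class_eq[OF E bracket_rep_cong_left] equiv_class_eq[OF E bracket_rep_cong_right]
    by (intro congruent2I[OF E E]) simp_all
  from UN_equiv_class2[OF E E this, of m1 m2] show ?thesis
    using assms by (simp add: bracket_def)
qed

lemma anchor_rep_bracket_rep:
  assumes m: "smooth m1" "smooth m2"
    and integrable: "\<And>x u v w. wedge21 (ext_deriv \<omega>) \<omega> x u v w = 0"
  shows "anchor_rep \<omega> g (bracket_rep \<omega> g m1 m2) =
    lie_bracket (anchor_rep \<omega> g m1) (anchor_rep \<omega> g m2)"
    (is "_ = lie_bracket ?X1 ?X2")
proof
  fix x
  \<comment> \<open>With the minus sign included, the anchored fields are sums
    \<open>m + ?a m g\<close>, and the coefficients in the expansion agree with those of
    \<open>bracket_rep\<close>, signs included.\<close>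
  let ?a = "\<lambda>m x. - (contract \<omega> m x / contract \<omega> g x)"
  have a: "smooth (?a m1)" "smooth (?a m2)"
    by (rule smooth_uminus[OF smooth_contract_ratio[OF m(1)]] smooth_uminus[OF smooth_contract_ratio[OF m(2)]])+
  obtain c where "lie_bracket (\<lambda>x. m1 x + ?a m1 x *\<^sub>R g x) (\<lambda>x. m2 x + ?a m2 x *\<^sub>R g x) x =
      lie_bracket m1 m2 x + ?a m1 x *\<^sub>R lie_bracket g m2 x - ?a m2 x *\<^sub>R lie_bracket g m1 x + c *\<^sub>R g x"
    using lie_bracket_add_scaleR[OF m(1) a(1) g m(2) a(2)] by blast
  then have "lie_bracket ?X1 ?X2 x - bracket_rep \<omega> g m1 m2 x = c *\<^sub>R g x"
    by (simp add: anchor_rep_def bracket_rep_def)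
  \<comment> \<open>Here \<open>c\<close> depends on the fixed point \<open>x\<close>, so the
    pointwise congruence is applied instead of \<open>mod_span_rel\<close>.\<close>
  then have "anchor_rep \<omega> g (bracket_rep \<omega> g m1 m2) x = anchor_rep \<omega> g (lie_bracket ?X1 ?X2) x"
    by (rule anchor_rep_cong[symmetric])
  also have "contract \<omega> (lie_bracket ?X1 ?X2) x = 0"
    using lie_bracket_in_kernel[OF \<omega> smooth_anchor_rep smooth_anchor_rep contract_anchor_rep
        contract_anchor_rep transversal integrable] m by blast
  then have "anchor_rep \<omega> g (lie_bracket ?X1 ?X2) x = lie_bracket ?X1 ?X2 x"
    by (rule anchor_rep_eq_self)
  finally show "anchor_rep \<omega> g (bracket_rep \<omega> g m1 m2) x = lie_bracket ?X1 ?X2 x" .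
qed

end

theorem lemma10:
  fixes g :: "real ^ 'n \<Rightarrow> real ^ 'n"
    and \<omega> :: "real ^ 'n \<Rightarrow> ((real ^ 'n) \<Rightarrow>\<^sub>L real)"
    and M1 M2 :: "(real ^ 'n \<Rightarrow> real ^ 'n) set"
  assumes "smooth g"
    and "smooth \<omega>"
    and "\<forall>x. contract \<omega> g x \<noteq> 0"
    and "\<forall>x u v w. wedge21 (ext_deriv \<omega>) \<omega> x u v w = 0"
    and "M1 \<in> quotient_sections g"
    and "M2 \<in> quotient_sections g"
  shows "anchor \<omega> g (bracket \<omega> g M1 M2) = lie_bracket (anchor \<omega> g M1) (anchor \<omega> g M2)"
proof -
  obtain m1 m2 where "smooth m1" "smooth m2"
    and "M1 = mod_span_rel g `` {m1}" "M2 = mod_span_rel g `` {m2}"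
    using assms(5,6) by (auto simp: quotient_sections_def elim!: quotientE)
  then show ?thesis
    using assms(1-4)
    \<comment> \<open>\<open>smooth_bracket_rep\<close> makes \<open>anchor_class\<close> applicable
      to the class of the bracket, which reduces the claim to representatives.\<close>
    by (simp add: anchor_class bracket_class smooth_bracket_rep anchor_rep_bracket_rep)
qed

end
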